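(* Let $\{Z(t)\}_{t\ge0}$ be an $\mathcal F_t$-adapted $H$-valued stochastic process with $|Z(t)|=1$ for all $t\ge 0$, and let $\Gamma_Z(t):=Z(t)\otimes Y(t)$. Then the tensor Heston stochastic variance process $\mathcal V(t)=Y(t)^{\otimes 2}$ can be decomposed as $$\mathcal V(t)=\Gamma_Z(t)\,\Gamma_Z^*(t)$$ for all $t\ge0$, where the adjoint of $\Gamma_Z(t)$ is $\Gamma_Z^*(t)=Y(t)\otimes Z(t)$.
   Context: $(\Omega,\mathcal F,\{\mathcal F_t\}_{t\ge0},\mathbb P)$ is a filtered probability space. $H$ is a real separable Hilbert space with inner product $\langle\cdot,\cdot\rangle$ and norm $|\cdot|$; $L(H)$ is the space of bounded linear operators on $H$. For $f,g\in H$ the tensor product is the operator $f\otimes g:=\langle f,\cdot\rangle g$, and $f^{\otimes2}:=f\otimes f$. $\{W(t)\}_{t\ge0}$ is an $H$-valued $\mathcal F_t$-Wiener process with covariance operator $Q_W$ (symmetric, positive definite, trace class). $\mathcal A$ is a densely defined operator on $H$ generating a $C_0$-semigroup $\{\mathcal U(t)\}_{t\ge0}$, $\eta\in L(H)$, $Y_0\in H$. $\{Y(t)\}_{t\ge0}$ is the mild solution of $dY(t)=\mathcal AY(t)\,dt+\eta\,dW(t)$, $Y(0)=Y_0$, i.e. $Y(t)=\mathcal U(t)Y_0+\int_0^t\mathcal U(t-s)\eta\,dW(s)$. *)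

theory Defs
  imports "HOL-Probability.Probability"
begin

text \<open>
  Throughout, a real separable Hilbert space is a type of sort
  \<open>{real_inner, complete_space, second_countable_topology}\<close>, and L(H) is the library type
  \<open>'h \<Rightarrow>\<^sub>L 'h\<close>.  Time is \<open>real\<close>; only values at \<open>t \<ge> 0\<close> are ever constrained or used.
\<close>

subsection \<open>Operators on a Hilbert space\<close>

definition tensor :: "'h::real_inner \<Rightarrow> 'h \<Rightarrow> 'h \<Rightarrow>\<^sub>L 'h"  (infix \<open>\<otimes>\<^sub>H\<close> 75)
  where "f \<otimes>\<^sub>H g = Blinfun (\<lambda>h. (f \<bullet> h) *\<^sub>R g)"

text \<open>The function passed to \<open>Blinfun\<close> is bounded linear, so \<open>tensor\<close> is the intended operator.\<close>

lemma tensor_apply: "blinfun_apply (f \<otimes>\<^sub>H g) h = (f \<bullet> h) *\<^sub>R g"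
proof -
  have "bounded_linear (\<lambda>h. (f \<bullet> h) *\<^sub>R g)"
    by (rule bounded_linear_scaleR_const[OF bounded_linear_inner_right])
  then show ?thesis
    by (simp add: tensor_def bounded_linear_Blinfun_apply)
qed

text \<open>The library's \<open>adjoint\<close> of the underlying function, viewed again as an element of L(H).\<close>

definition op_adjoint :: "('h::real_inner \<Rightarrow>\<^sub>L 'h) \<Rightarrow> ('h \<Rightarrow>\<^sub>L 'h)"
  where "op_adjoint A = Blinfun (adjoint (blinfun_apply A))"

definition orthonormal_basis :: "'h::real_inner set \<Rightarrow> bool"
  where "orthonormal_basis B \<longleftrightarrow>
    pairwise orthogonal B \<and> (\<forall>e\<in>B. norm e = 1) \<and> closure (span B) = UNIV"

text \<open>
  Trace of a nonnegative operator, with values in \<open>[0, \<infinity>]\<close>; for such operators it does not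
  depend on the chosen orthonormal basis.  It is only used for nonnegative operators.
\<close>

definition pos_trace :: "('h::real_inner \<Rightarrow>\<^sub>L 'h) \<Rightarrow> ennreal"
  where "pos_trace T =
    (\<Sum>\<^sub>\<infinity>e\<in>(SOME B. orthonormal_basis B). ennreal (blinfun_apply T e \<bullet> e))"

text \<open>For a symmetric positive operator, trace class means finite trace.\<close>

definition covariance_operator :: "('h::real_inner \<Rightarrow>\<^sub>L 'h) \<Rightarrow> bool"
  where "covariance_operator Q \<longleftrightarrow>
    (\<forall>x y. blinfun_apply Q x \<bullet> y = x \<bullet> blinfun_apply Q y) \<and>
    (\<forall>x. x \<noteq> 0 \<longrightarrow> blinfun_apply Q x \<bullet> x > 0) \<and>
    pos_trace Q < \<infinity>"

text \<open>
  The squared Hilbert-Schmidt norm of \<open>A Q\<^sup>1\<^sup>/\<^sup>2\<close>, written as the trace of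
  \<open>A Q A\<^sup>* = (A Q\<^sup>1\<^sup>/\<^sup>2) (A Q\<^sup>1\<^sup>/\<^sup>2)\<^sup>*\<close>.
\<close>

definition HS_norm2 :: "('h::real_inner \<Rightarrow>\<^sub>L 'h) \<Rightarrow> ('h \<Rightarrow>\<^sub>L 'h) \<Rightarrow> ennreal"
  where "HS_norm2 Q A = pos_trace (A o\<^sub>L Q o\<^sub>L op_adjoint A)"

subsection \<open>Semigroups\<close>

definition C0_semigroup :: "(real \<Rightarrow> 'h::real_normed_vector \<Rightarrow>\<^sub>L 'h) \<Rightarrow> bool"
  where "C0_semigroup U \<longleftrightarrow>
    U 0 = id_blinfun \<and>
    (\<forall>s\<ge>0. \<forall>t\<ge>0. U (s + t) = U s o\<^sub>L U t) \<and>
    (\<forall>x. ((\<lambda>t. blinfun_apply (U t) x) \<longlongrightarrow> x) (at_right 0))"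

text \<open>An unbounded operator is given by its domain \<open>D\<close> and its values \<open>A x\<close> for \<open>x \<in> D\<close>.\<close>

definition densely_defined_operator ::
    "'h::real_normed_vector set \<Rightarrow> ('h \<Rightarrow> 'h) \<Rightarrow> bool"
  where "densely_defined_operator D A \<longleftrightarrow>
    subspace D \<and> closure D = UNIV \<and>
    (\<forall>x\<in>D. \<forall>y\<in>D. A (x + y) = A x + A y) \<and>
    (\<forall>c. \<forall>x\<in>D. A (c *\<^sub>R x) = c *\<^sub>R A x)"

definition generates ::
    "'h::real_normed_vector set \<Rightarrow> ('h \<Rightarrow> 'h) \<Rightarrow> (real \<Rightarrow> 'h \<Rightarrow>\<^sub>L 'h) \<Rightarrow> bool"
  where "generates D A U \<longleftrightarrow>
    D = {x. \<exists>y. ((\<lambda>t. (blinfun_apply (U t) x - x) /\<^sub>R t) \<longlongrightarrow> y) (at_right 0)} \<and>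
    (\<forall>x\<in>D. ((\<lambda>t. (blinfun_apply (U t) x - x) /\<^sub>R t) \<longlongrightarrow> A x) (at_right 0))"

subsection \<open>Filtrations and Wiener processes\<close>

definition filtered_prob_space :: "'a measure \<Rightarrow> (real \<Rightarrow> 'a measure) \<Rightarrow> bool"
  where "filtered_prob_space M F \<longleftrightarrow>
    prob_space M \<and>
    (\<forall>t\<ge>0. subalgebra M (F t)) \<and>
    (\<forall>s t. 0 \<le> s \<longrightarrow> s \<le> t \<longrightarrow> subalgebra (F t) (F s))"

definition adapted_process ::
    "(real \<Rightarrow> 'a measure) \<Rightarrow> (real \<Rightarrow> 'a \<Rightarrow> 'h::topological_space) \<Rightarrow> bool"
  where "adapted_process F X \<longleftrightarrow> (\<forall>t\<ge>0. X t \<in> borel_measurable (F t))"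

text \<open>
  The law of \<open>X\<close> is the centred Gaussian measure on H with covariance operator \<open>C\<close>: every
  \<open>f \<bullet> X\<close> is normal with mean 0 and variance \<open>C f \<bullet> f\<close>, where variance 0 means that the
  variable vanishes almost surely.
\<close>

definition centered_gaussian ::
    "'a measure \<Rightarrow> ('a \<Rightarrow> 'h::real_inner) \<Rightarrow> ('h \<Rightarrow>\<^sub>L 'h) \<Rightarrow> bool"
  where "centered_gaussian M X C \<longleftrightarrow>
    X \<in> borel_measurable M \<and>
    (\<forall>f. if blinfun_apply C f \<bullet> f = 0 then (AE \<omega> in M. f \<bullet> X \<omega> = 0)
         else distributed M lborel (\<lambda>\<omega>. f \<bullet> X \<omega>)
                (\<lambda>x. ennreal (normal_density 0 (sqrt (blinfun_apply C f \<bullet> f)) x)))"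

definition wiener_process ::
    "'a measure \<Rightarrow> (real \<Rightarrow> 'a measure) \<Rightarrow> ('h::real_inner \<Rightarrow>\<^sub>L 'h) \<Rightarrow> (real \<Rightarrow> 'a \<Rightarrow> 'h) \<Rightarrow> bool"
  where "wiener_process M F Q W \<longleftrightarrow>
    adapted_process F W \<and>
    (AE \<omega> in M. W 0 \<omega> = 0) \<and>
    (AE \<omega> in M. continuous_on {0..} (\<lambda>t. W t \<omega>)) \<and>
    (\<forall>s t. 0 \<le> s \<longrightarrow> s \<le> t \<longrightarrow>
       prob_space.indep_set M (sets (F s))
         {(\<lambda>\<omega>. W t \<omega> - W s \<omega>) -` B \<inter> space M | B. B \<in> sets borel} \<and>
       centered_gaussian M (\<lambda>\<omega>. W t \<omega> - W s \<omega>) ((t - s) *\<^sub>R Q))"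

subsection \<open>Stochastic integral and mild solution\<close>

definition step_integrand ::
    "nat \<Rightarrow> (nat \<Rightarrow> real) \<Rightarrow> (nat \<Rightarrow> 'h::real_normed_vector \<Rightarrow>\<^sub>L 'h) \<Rightarrow> real \<Rightarrow> 'h \<Rightarrow>\<^sub>L 'h"
  where "step_integrand n p A s = (\<Sum>i<n. indicator {p i<..p (Suc i)} s *\<^sub>R A i)"

definition step_integral ::
    "(real \<Rightarrow> 'a \<Rightarrow> 'h) \<Rightarrow> nat \<Rightarrow> (nat \<Rightarrow> real) \<Rightarrow> (nat \<Rightarrow> 'h::real_normed_vector \<Rightarrow>\<^sub>L 'h) \<Rightarrow> 'a \<Rightarrow> 'h"
  where "step_integral W n p A \<omega> =
    (\<Sum>i<n. blinfun_apply (A i) (W (p (Suc i)) \<omega> - W (p i) \<omega>))"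

text \<open>
  \<open>I\<close> is (a version of) the stochastic integral over \<open>[0,t]\<close> of the deterministic operator-valued
  integrand \<open>\<Phi>\<close> against the Wiener process \<open>W\<close> with covariance operator \<open>Q\<close>: it is the
  mean-square limit of integrals of step functions which converge to \<open>\<Phi>\<close> in the norm of the
  Ito isometry.  It is a relation because the integral is determined only almost surely.
\<close>

definition has_stochastic_integral ::
    "'a measure \<Rightarrow> ('h::real_inner \<Rightarrow>\<^sub>L 'h) \<Rightarrow> (real \<Rightarrow> 'a \<Rightarrow> 'h) \<Rightarrow> real \<Rightarrow>
     (real \<Rightarrow> 'h \<Rightarrow>\<^sub>L 'h) \<Rightarrow> ('a \<Rightarrow> 'h) \<Rightarrow> bool"
  where "has_stochastic_integral M Q W t \<Phi> I \<longleftrightarrow>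
    I \<in> borel_measurable M \<and>
    (\<forall>x. set_borel_measurable lborel {0..t} (\<lambda>s. blinfun_apply (\<Phi> s) x)) \<and>
    (\<exists>n p A.
      (\<forall>k. p k 0 = 0 \<and> p k (n k) = t \<and> (\<forall>i<n k. p k i \<le> p k (Suc i))) \<and>
      (\<lambda>k. \<integral>\<^sup>+s\<in>{0..t}. HS_norm2 Q (\<Phi> s - step_integrand (n k) (p k) (A k) s) \<partial>lborel)
        \<longlonglongrightarrow> 0 \<and>
      (\<lambda>k. \<integral>\<^sup>+\<omega>. ennreal ((norm (I \<omega> - step_integral W (n k) (p k) (A k) \<omega>))\<^sup>2) \<partial>M)
        \<longlonglongrightarrow> 0)"

text \<open>
  \<open>Y(t) = U(t) Y\<^sub>0 + \<integral>\<^sub>0\<^sup>t U(t - s) \<eta> dW(s)\<close> almost surely, for every \<open>t \<ge> 0\<close>; the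
  \<open>I\<close> of the preceding definition is here \<open>Y(t) - U(t) Y\<^sub>0\<close>.
\<close>

definition mild_solution ::
    "'a measure \<Rightarrow> ('h::real_inner \<Rightarrow>\<^sub>L 'h) \<Rightarrow> (real \<Rightarrow> 'a \<Rightarrow> 'h) \<Rightarrow> (real \<Rightarrow> 'h \<Rightarrow>\<^sub>L 'h) \<Rightarrow>
     ('h \<Rightarrow>\<^sub>L 'h) \<Rightarrow> 'h \<Rightarrow> (real \<Rightarrow> 'a \<Rightarrow> 'h) \<Rightarrow> bool"
  where "mild_solution M Q W U \<eta> Y0 Y \<longleftrightarrow>
    (\<forall>t\<ge>0. has_stochastic_integral M Q W t (\<lambda>s. U (t - s) o\<^sub>L \<eta>)
             (\<lambda>\<omega>. Y t \<omega> - blinfun_apply (U t) Y0))"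

subsection \<open>The variance process\<close>

definition heston_variance :: "(real \<Rightarrow> 'a \<Rightarrow> 'h::real_inner) \<Rightarrow> real \<Rightarrow> 'a \<Rightarrow> 'h \<Rightarrow>\<^sub>L 'h"
  where "heston_variance Y t \<omega> = Y t \<omega> \<otimes>\<^sub>H Y t \<omega>"

definition Gamma_op ::
    "(real \<Rightarrow> 'a \<Rightarrow> 'h::real_inner) \<Rightarrow> (real \<Rightarrow> 'a \<Rightarrow> 'h) \<Rightarrow> real \<Rightarrow> 'a \<Rightarrow> 'h \<Rightarrow>\<^sub>L 'h"
  where "Gamma_op Z Y t \<omega> = Z t \<omega> \<otimes>\<^sub>H Y t \<omega>"

end

theory Submission
  imports Defs
begin

text \<open>The claim is rank-one algebra at each fixed t and outcome. Taking the adjoint swaps the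
  factors of a tensor (\<open>op_adjoint_tensor\<close>), and composing two tensors contracts the
  inner factors to a scalar (\<open>tensor_compose_tensor\<close>). Hence \<Gamma>\<Gamma>* = (Z
  \<bullet> Z) Y \<otimes> Y, and the scalar is 1 since Z is a unit vector.\<close>

lemma op_adjoint_tensor: "op_adjoint (f \<otimes>\<^sub>H g) = g \<otimes>\<^sub>H f"
proof -
  have "adjoint (blinfun_apply (f \<otimes>\<^sub>H g)) = blinfun_apply (g \<otimes>\<^sub>H f)"
    \<comment> \<open>\<open>adjoint\<close> is defined by choice, so it is pinned down by its
      defining identity: pairing the image of x with y gives (f \<bullet> x)(g \<bullet> y) on both
      sides.\<close>
    by (rule adjoint_unique) (simp add: tensor_apply inner_commute)
  then show ?thesis
    by (simp add: op_adjoint_def blinfun_apply_inverse)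
qed

text \<open>The right factor sends x to (h \<bullet> x) k, and the left one then pulls out f
  \<bullet> k.\<close>

lemma tensor_compose_tensor: "(f \<otimes>\<^sub>H g) o\<^sub>L (h \<otimes>\<^sub>H k) = (f \<bullet> k) *\<^sub>R (h \<otimes>\<^sub>H g)"
  by (rule blinfun_eqI) (simp add: tensor_apply scaleR_blinfun.rep_eq mult.commute)

theorem proposition7:
  fixes M :: "'a measure" and F :: "real \<Rightarrow> 'a measure"
    and Q \<eta> :: "'h::{real_inner, complete_space, second_countable_topology} \<Rightarrow>\<^sub>L 'h"
    and W Y Z :: "real \<Rightarrow> 'a \<Rightarrow> 'h"
    and D :: "'h set" and A :: "'h \<Rightarrow> 'h" and U :: "real \<Rightarrow> 'h \<Rightarrow>\<^sub>L 'h"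
    and Y0 :: 'h
  assumes "filtered_prob_space M F"
    and "covariance_operator Q"
    and "wiener_process M F Q W"
    and "densely_defined_operator D A"
    and "C0_semigroup U"
    and "generates D A U"
    and "mild_solution M Q W U \<eta> Y0 Y"
    and "adapted_process F Z"
    and "\<forall>t\<ge>0. \<forall>\<omega>\<in>space M. norm (Z t \<omega>) = 1"
  shows "\<forall>t\<ge>0. \<forall>\<omega>\<in>space M.
           op_adjoint (Gamma_op Z Y t \<omega>) = Y t \<omega> \<otimes>\<^sub>H Z t \<omega> \<and>
           heston_variance Y t \<omega> = Gamma_op Z Y t \<omega> o\<^sub>L op_adjoint (Gamma_op Z Y t \<omega>)"
  \<comment> \<open>\<open>norm_eq_1\<close> turns the unit norm into Z \<bullet> Z = 1, the scalar
    left by the composition.\<close>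
  using assms(9)
  by (simp add: Gamma_op_def heston_variance_def op_adjoint_tensor tensor_compose_tensor
      norm_eq_1)

end
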